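(* Let $n\in\mathbb N$. For every $2$-colouring of the edges of the complete bipartite graph $K_{n,n}$ that is not a split colouring, there is a partition of $V(K_{n,n})$ into the vertex set of a monochromatic path and the vertex set of a monochromatic cycle, the path and the cycle being of different colours.
   Context: A $2$-colouring assigns each edge one of two colours (red and blue). Let $V_1,V_2$ be the partition classes of $K_{n,n}$. A split colouring is a colouring obtained (up to swapping colours) as follows: for $i=1,2$, partition $V_i$ into two non-empty sets $V_i^1,V_i^2$, and colour red all edges between $V_1^1$ and $V_2^1$ and all edges between $V_1^2$ and $V_2^2$, and colour all other edges blue (so each colour induces the disjoint union of two complete bipartite graphs). Conventions: a path may be empty or a single vertex; the empty set, a single vertex, and a single edge each also count as a cycle. A path or cycle is monochromatic in a given colour if all its edges have that colour; a path or cycle without edges may be regarded as having either colour. *)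

theory Defs
  imports Main
begin

datatype colour = Red | Blue

definition is_Knn :: "nat \<Rightarrow> 'a set \<Rightarrow> 'a set \<Rightarrow> bool" where
  "is_Knn n V1 V2 \<longleftrightarrow>
     finite V1 \<and> finite V2 \<and> card V1 = n \<and> card V2 = n \<and> V1 \<inter> V2 = {}"

definition bip_edges :: "'a set \<Rightarrow> 'a set \<Rightarrow> 'a set set" where
  "bip_edges V1 V2 = {{u, v} | u v. u \<in> V1 \<and> v \<in> V2}"

text \<open>A colouring is a total function on vertex sets; only its values on edges are ever used.
  The two colour names \<open>r\<close> and \<open>b\<close> are quantified to allow for swapping the colours.\<close>

definition split_colouring :: "'a set \<Rightarrow> 'a set \<Rightarrow> ('a set \<Rightarrow> colour) \<Rightarrow> bool" where
  "split_colouring V1 V2 c \<longleftrightarrow>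
     (\<exists>A1 A2 B1 B2 r b.
        A1 \<noteq> {} \<and> A2 \<noteq> {} \<and> A1 \<union> A2 = V1 \<and> A1 \<inter> A2 = {} \<and>
        B1 \<noteq> {} \<and> B2 \<noteq> {} \<and> B1 \<union> B2 = V2 \<and> B1 \<inter> B2 = {} \<and>
        r \<noteq> b \<and>
        (\<forall>u\<in>V1. \<forall>v\<in>V2.
           c {u, v} = (if (u \<in> A1 \<and> v \<in> B1) \<or> (u \<in> A2 \<and> v \<in> B2) then r else b)))"

text \<open>Paths and cycles are represented by the list of their vertices in order. The lists of
  length 0, 1 and 2 give the degenerate cycles (empty set, single vertex, single edge): for
  length 2 the closing edge coincides with the only edge of the path, and for length 1 there is
  no closing edge.\<close>

definition path_edges :: "'a list \<Rightarrow> 'a set set" where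
  "path_edges p = {{p ! i, p ! Suc i} | i. Suc i < length p}"

definition cycle_edges :: "'a list \<Rightarrow> 'a set set" where
  "cycle_edges p = (if length p \<le> 1 then {} else insert {last p, hd p} (path_edges p))"

definition is_path :: "'a set \<Rightarrow> 'a set set \<Rightarrow> 'a list \<Rightarrow> bool" where
  "is_path V E p \<longleftrightarrow> distinct p \<and> set p \<subseteq> V \<and> path_edges p \<subseteq> E"

definition is_cycle :: "'a set \<Rightarrow> 'a set set \<Rightarrow> 'a list \<Rightarrow> bool" where
  "is_cycle V E p \<longleftrightarrow> distinct p \<and> set p \<subseteq> V \<and> cycle_edges p \<subseteq> E"

definition monochromatic :: "('a set \<Rightarrow> colour) \<Rightarrow> colour \<Rightarrow> 'a set set \<Rightarrow> bool" where
  "monochromatic c r F \<longleftrightarrow> (\<forall>e\<in>F. c e = r)"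

end

theory Submission
  imports Defs
begin

text \<open>A partition into a red path and a blue path is enough: after balancing both paths, either
  one of them closes up to a cycle, or their end vertices allow the red path to take over the two
  end vertices of the blue one, and the blue path eventually degenerates to an edge.

  Depth-first search in the red graph, stopped when as many vertices are finished (\<open>D\<close>) as
  unvisited (\<open>U\<close>), leaves a red path \<open>p\<close> and two balanced blue bicliques between \<open>D\<close> and \<open>U\<close>.
  Unless these can be joined to one blue path, \<open>D\<close> and \<open>U\<close> are red bicliques. If \<open>p\<close> connects \<open>D\<close>
  to \<open>U\<close>, it swallows the smaller biclique. Otherwise \<open>p\<close> closes to a red cycle through, say, \<open>U\<close>,
  all edges to \<open>D\<close> are blue, and either the colouring is split or this cycle has a blue
  chord; a shortest blue chord joins the two blue bicliques while the cycle, minus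
  the chord's ends, still has a red Hamiltonian path.\<close>

section \<open>Counting, and Hamiltonian paths of complete bipartite graphs\<close>

lemma card_Int_parts:
  assumes "S \<subseteq> P \<union> D \<union> U" "finite P" "finite D" "finite U" "P \<inter> D = {}" "P \<inter> U = {}" "D \<inter> U = {}"
  shows "card S = card (P \<inter> S) + card (D \<inter> S) + card (U \<inter> S)"
proof -
  have "card S = card ((P \<inter> S \<union> D \<inter> S) \<union> U \<inter> S)" using assms(1) by (intro arg_cong[of _ _ card]) blast
  also have "\<dots> = card (P \<inter> S \<union> D \<inter> S) + card (U \<inter> S)"
    using assms(2-) by (intro card_Un_disjoint) auto
  also have "card (P \<inter> S \<union> D \<inter> S) = card (P \<inter> S) + card (D \<inter> S)"
    using assms(2-) by (intro card_Un_disjoint) auto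
  finally show ?thesis .
qed

lemma obtain_subset_containing:
  assumes "finite A" "a \<in> A" "1 \<le> m" "m \<le> card A"
  obtains S where "S \<subseteq> A" "card S = m" "a \<in> S"
proof -
  have "m - 1 \<le> card (A - {a})" using assms by simp
  then obtain T where T: "T \<subseteq> A - {a}" "card T = m - 1" "finite T"
    by (rule obtain_subset_with_card_n)
  show ?thesis
  proof (rule that[of "insert a T"])
    show "card (insert a T) = m" using T assms(3) by (subst card_insert_disjoint) auto
  qed (use T assms in auto)
qed

text \<open>Peel off \<open>a\<close> together with a vertex of \<open>B\<close> other than
  \<open>b\<close>: the prescribed last vertex survives, and the remaining path may start at any
  other vertex of \<open>A\<close>.\<close>

lemma biclique_path:
  assumes "finite A" "finite B" "card A = card B" "A \<inter> B = {}" "a \<in> A" "b \<in> B"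
    and "\<And>x y. x \<in> A \<Longrightarrow> y \<in> B \<Longrightarrow> E x y \<and> E y x"
  shows "\<exists>p. distinct p \<and> set p = A \<union> B \<and> successively E p \<and> p \<noteq> [] \<and> hd p = a \<and> last p = b"
  using assms
proof (induction "card A" arbitrary: A B a)
  case 0
  then show ?case by auto
next
  case (Suc k)
  show ?case
  proof (cases "k = 0")
    case True
    then have "card A = 1" "card B = 1" using Suc by auto
    then have "A = {a}" "B = {b}" using Suc.prems(5,6) by (auto simp: card_1_singleton_iff)
    then show ?thesis using Suc.prems by (intro exI[of _ "[a, b]"]) auto
  next
    case False
    have "card (A - {a}) = k" "card (B - {b}) = k"
      using Suc.hyps(2) Suc.prems(1,2,3,5,6) by auto
    then have "A - {a} \<noteq> {}" "B - {b} \<noteq> {}" using False by (metis card.empty)+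
    then obtain a' b' where ab: "a' \<in> A" "a' \<noteq> a" "b' \<in> B" "b' \<noteq> b" by blast
    have "\<exists>p. distinct p \<and> set p = (A - {a}) \<union> (B - {b'}) \<and> successively E p \<and> p \<noteq> []
        \<and> hd p = a' \<and> last p = b"
      by (rule Suc.hyps(1)) (use Suc.prems Suc.hyps(2) ab in auto)
    then obtain p where "distinct p" "set p = (A - {a}) \<union> (B - {b'})" "successively E p" "p \<noteq> []"
      "hd p = a'" "last p = b" by blast
    moreover have "E a b'" "E b' a'" using Suc.prems(5,7) ab by blast+
    moreover have "insert a (insert b' ((A - {a}) \<union> (B - {b'}))) = A \<union> B" "a \<notin> B" "b' \<notin> A"
      using Suc.prems(4,5) ab by blast+
    moreover have "a \<noteq> b'" using Suc.prems(4,5) ab by blast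
    ultimately show ?thesis
      by (intro exI[of _ "a # b' # p"]) (simp add: successively_Cons)
  qed
qed

text \<open>If \<open>A\<close> is larger by one, removing \<open>a\<close> leaves equal sides, and
  a path of the rest that starts in \<open>B\<close> can be preceded by \<open>a\<close>.\<close>

lemma biclique_path_from:
  assumes "finite A" "finite B" "card A = card B \<or> card A = Suc (card B)" "A \<inter> B = {}" "a \<in> A"
    and E: "\<And>x y. x \<in> A \<Longrightarrow> y \<in> B \<Longrightarrow> E x y \<and> E y x"
  shows "\<exists>p. distinct p \<and> set p = A \<union> B \<and> successively E p \<and> p \<noteq> [] \<and> hd p = a"
proof (cases "card A = card B")
  case True
  then obtain b where "b \<in> B" using assms by (metis card_gt_0_iff ex_in_conv)
  then show ?thesis using biclique_path[of A B a b E] assms True by auto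
next
  case False
  then have c: "card (A - {a}) = card B" using assms by auto
  show ?thesis
  proof (cases "B = {}")
    case True
    then have "card A = 1" using False assms(3) by simp
    then have "A = {a}" using assms(5) by (auto simp: card_1_singleton_iff)
    then show ?thesis using True by (intro exI[of _ "[a]"]) auto
  next
    case False
    then obtain b where b: "b \<in> B" by blast
    have "A - {a} \<noteq> {}" using c False assms(2) by (metis card_0_eq card.empty)
    then obtain a' where a': "a' \<in> A - {a}" by blast
    have "\<exists>p. distinct p \<and> set p = B \<union> (A - {a}) \<and> successively E p \<and> p \<noteq> [] \<and> hd p = b \<and> last p = a'"
      by (rule biclique_path) (use assms b c a' in auto)
    then obtain p where "distinct p" "set p = B \<union> (A - {a})" "successively E p" "p \<noteq> []" "hd p = b"
      by blast
    moreover have "E a b" using E assms(5) b by blast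
    moreover have "insert a (B \<union> (A - {a})) = A \<union> B" "a \<notin> B" using assms(4,5) by blast+
    ultimately show ?thesis
      by (intro exI[of _ "a # p"]) (simp add: successively_Cons)
  qed
qed

lemma biclique_path_balanced:
  assumes "finite A" "finite B" "card A = card B" "A \<inter> B = {}"
    and "\<And>x y. x \<in> A \<Longrightarrow> y \<in> B \<Longrightarrow> E x y \<and> E y x"
  shows "\<exists>p. distinct p \<and> set p = A \<union> B \<and> successively E p"
proof (cases "A = {}")
  case True
  then show ?thesis using assms by (intro exI[of _ "[]"]) auto
next
  case False
  then obtain a where "a \<in> A" by blast
  then show ?thesis using biclique_path_from[of A B a E] assms by blast
qed

section \<open>Partitions into paths and cycles, and depth-first search\<close>

definition two_paths :: "'a set \<Rightarrow> ('a \<Rightarrow> 'a \<Rightarrow> bool) \<Rightarrow> ('a \<Rightarrow> 'a \<Rightarrow> bool) \<Rightarrow> bool" where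
  "two_paths V R B \<longleftrightarrow>
     (\<exists>r s. distinct (r @ s) \<and> set (r @ s) = V \<and> successively R r \<and> successively B s)"

text \<open>On two vertices the closing edge is the only edge read backwards, so for symmetric
  \<open>E\<close> a single edge counts as a cycle.\<close>

definition cyclic :: "('a \<Rightarrow> 'a \<Rightarrow> bool) \<Rightarrow> 'a list \<Rightarrow> bool" where
  "cyclic E q \<longleftrightarrow> successively E q \<and> (length q \<le> 1 \<or> E (last q) (hd q))"

definition path_and_cycle :: "'a set \<Rightarrow> ('a \<Rightarrow> 'a \<Rightarrow> bool) \<Rightarrow> ('a \<Rightarrow> 'a \<Rightarrow> bool) \<Rightarrow> bool" where
  "path_and_cycle V R B \<longleftrightarrow>
     (\<exists>p q. distinct (p @ q) \<and> set (p @ q) = V \<and>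
        (successively R p \<and> cyclic B q \<or> successively B p \<and> cyclic R q))"

lemma two_pathsI:
  assumes "distinct r" "distinct s" "set r \<inter> set s = {}" "set r \<union> set s = V"
    "successively R r" "successively B s"
  shows "two_paths V R B"
  unfolding two_paths_def by (rule exI[of _ r], rule exI[of _ s]) (use assms in auto)

lemma successively_rev_sym:
  assumes "\<And>u v. E u v \<Longrightarrow> E v u"
  shows "successively E (rev p) = successively E p"
proof -
  have "(\<lambda>x y. E y x) = E" using assms by blast
  then show ?thesis by (simp only: successively_rev)
qed

text \<open>The list \<open>p\<close> is the search stack with its top at the head. A vertex passes
  from \<open>p\<close> to \<open>D\<close> only when it has no neighbour left in \<open>U\<close>,
  so no edge ever joins \<open>D\<close> to \<open>U\<close>. Each step moves one vertex, from
  \<open>U\<close> to \<open>p\<close> or from \<open>p\<close> to \<open>D\<close>; the surplus of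
  \<open>U\<close> over \<open>D\<close> drops by exactly one and cannot skip zero.\<close>

lemma finite_path_dfs:
  assumes "finite V" "\<And>u v. E u v \<Longrightarrow> E v u"
  shows "\<exists>p D U. distinct p \<and> successively E p \<and> set p \<union> D \<union> U = V \<and> set p \<inter> D = {} \<and>
     set p \<inter> U = {} \<and> D \<inter> U = {} \<and> card U = card D \<and> (\<forall>d\<in>D. \<forall>u\<in>U. \<not> E d u)"
proof -
  have "\<exists>p D U. distinct p \<and> successively E p \<and> set p \<union> D \<union> U = V \<and> set p \<inter> D = {} \<and>
     set p \<inter> U = {} \<and> D \<inter> U = {} \<and> card U = card D + (card V - k) \<and> (\<forall>d\<in>D. \<forall>u\<in>U. \<not> E d u)"
    if "k \<le> card V" for k
    using that
  proof (induction k)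
    case 0
    show ?case by (intro exI[of _ "[]"] exI[of _ "{}"] exI[of _ V]) auto
  next
    case (Suc k)
    then obtain p D U where *: "distinct p" "successively E p" "set p \<union> D \<union> U = V" "set p \<inter> D = {}"
     "set p \<inter> U = {}" "D \<inter> U = {}" "card U = card D + (card V - k)" "\<forall>d\<in>D. \<forall>u\<in>U. \<not> E d u"
      by auto
    have fin: "finite D" "finite U" using assms(1) *(3) by auto
    show ?case
    \<comment> \<open>An empty stack is restarted with any unvisited vertex.\<close>
    proof (cases "\<exists>u\<in>U. p = [] \<or> E u (hd p)")
      case True
      then obtain u where u: "u \<in> U" "p = [] \<or> E u (hd p)" by blast
      then have "card (U - {u}) = card D + (card V - Suc k)" using *(7) Suc.prems fin by simp
      moreover have "insert u (set p) \<union> D \<union> (U - {u}) = V" "u \<notin> set p" "u \<notin> D"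
        using *(3,5,6) u(1) by blast+
      ultimately show ?thesis
        by (intro exI[of _ "u # p"] exI[of _ D] exI[of _ "U - {u}"])
          (use *(1,2,4-6,8) u(2) in \<open>simp add: successively_Cons Int_Diff Diff_Int_distrib2 disjoint_iff\<close>)
    next
      case False
      have "U \<noteq> {}" using *(7) Suc.prems by auto
      with False obtain v q where p: "p = v # q" by (cases p) auto
      have "v \<notin> D" using *(4) p by auto
      then have "card U = card (insert v D) + (card V - Suc k)" using *(7) Suc.prems fin by simp
      moreover have "set q \<union> insert v D \<union> U = V" "set q \<inter> insert v D = {}" "set q \<inter> U = {}"
        "insert v D \<inter> U = {}" using *(1,3-6) p by auto
      moreover have "\<forall>d\<in>insert v D. \<forall>u\<in>U. \<not> E d u" using False assms(2) *(8) by (auto simp: p)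
      moreover have "distinct q" "successively E q" using *(1,2) by (auto simp: p successively_Cons)
      ultimately show ?thesis by blast
    qed
  qed
  from this[of "card V"] show ?thesis by simp
qed

section \<open>From two paths to a path and a cycle\<close>

text \<open>The colours are two relations, treated alike, so that facts transfer between colours and
  between sides by interpretation.\<close>

locale bicoloured =
  fixes X Y :: "'a set" and R B :: "'a \<Rightarrow> 'a \<Rightarrow> bool"
  assumes fin: "finite X" "finite Y"
    and card_eq: "card X = card Y"
    and disj: "X \<inter> Y = {}"
    and R_sym: "R u v \<Longrightarrow> R v u"
    and B_sym: "B u v \<Longrightarrow> B v u"
    and R_bip: "R u v \<Longrightarrow> u \<in> X \<and> v \<in> Y \<or> u \<in> Y \<and> v \<in> X"
    and B_bip: "B u v \<Longrightarrow> u \<in> X \<and> v \<in> Y \<or> u \<in> Y \<and> v \<in> X"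
    and R_or_B: "u \<in> X \<Longrightarrow> v \<in> Y \<Longrightarrow> R u v \<or> B u v"
    and not_R_B: "R u v \<Longrightarrow> \<not> B u v"
begin

lemma swap_sides: "bicoloured Y X R B"
proof
  show "R u v \<or> B u v" if "u \<in> Y" "v \<in> X" for u v
    using R_or_B R_sym B_sym that by blast
next
  show "R v u" if "R u v" for u v using that by (rule R_sym)
next
  show "B v u" if "B u v" for u v using that by (rule B_sym)
qed (use fin card_eq disj in \<open>auto dest: R_bip B_bip not_R_B\<close>)

lemma swap_colours: "bicoloured X Y B R"
proof
  show "B u v \<or> R u v" if "u \<in> X" "v \<in> Y" for u v
    using R_or_B that by blast
next
  show "R v u" if "R u v" for u v using that by (rule R_sym)
next
  show "B v u" if "B u v" for u v using that by (rule B_sym)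
qed (use fin card_eq disj in \<open>auto dest: R_bip B_bip not_R_B\<close>)

lemma R_or_B': "u \<in> Y \<Longrightarrow> v \<in> X \<Longrightarrow> R u v \<or> B u v"
  using R_or_B R_sym B_sym by blast

lemma R_rev: "successively R (rev p) = successively R p"
  using R_sym by (rule successively_rev_sym)

lemma B_rev: "successively B (rev p) = successively B p"
  using B_sym by (rule successively_rev_sym)

lemma last_side:
  assumes "successively R p" "p \<noteq> []" "hd p \<in> X"
  shows "if even (length p) then last p \<in> Y else last p \<in> X"
  using assms(2,1,3)
proof (induction p rule: rev_nonempty_induct)
  case (single x)
  then show ?case by auto
next
  case (snoc x p)
  then show ?case using R_bip[of "last p" x] disj by (auto simp: successively_append_iff split: if_splits)
qed

text \<open>Sides alternate along the path, so the two counts differ only through its ends. The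
  corrections are added on both sides of the equation to avoid truncated subtraction on
  \<open>nat\<close>.\<close>

lemma path_balance:
  assumes "successively R p" "p \<noteq> []" "distinct p" "set p \<subseteq> X \<union> Y"
  shows "card (set p \<inter> X) + of_bool (last p \<in> Y) = card (set p \<inter> Y) + of_bool (hd p \<in> X)"
  using assms(2,1,3,4)
proof (induction p rule: list_nonempty_induct)
  case (single x)
  then show ?case using disj by auto
next
  case (cons x p)
  have xp: "R x (hd p)" using cons by (cases p) auto
  have IH: "card (set p \<inter> X) + of_bool (last p \<in> Y) = card (set p \<inter> Y) + of_bool (hd p \<in> X)"
    using cons by (auto simp: successively_Cons)
  have n: "x \<notin> set p" using cons by auto
  show ?case
  proof (cases "x \<in> X")
    case True
    then have "hd p \<in> Y" "x \<notin> Y" "hd p \<notin> X" using R_bip[OF xp] disj by auto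
    then show ?thesis using True IH cons.hyps n by (auto simp: Int_insert_left)
  next
    case False
    then have "hd p \<in> X" "x \<in> Y" using R_bip[OF xp] by auto
    then show ?thesis using False IH cons.hyps n by (auto simp: Int_insert_left)
  qed
qed

text \<open>Induction on the length of the blue path. If neither path closes up, the edges between
  their ends either let \<open>r\<close> absorb both ends of \<open>s\<close>, or turn
  \<open>s\<close> and the ends of \<open>r\<close> into a blue cycle.\<close>

lemma even_path_and_cycle:
  assumes "distinct (r @ s)" "set (r @ s) = X \<union> Y" "successively R r" "successively B s"
    "r = [] \<or> hd r \<in> X \<and> last r \<in> Y" "s = [] \<or> hd s \<in> X \<and> last s \<in> Y"
  shows "path_and_cycle (X \<union> Y) R B"
  using assms
proof (induction "length s" arbitrary: r s rule: less_induct)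
  case less
  have RcycI: "path_and_cycle (X \<union> Y) R B" if "cyclic R q" "successively B p" "distinct (p @ q)" "set (p @ q) = X \<union> Y" for p q
    unfolding path_and_cycle_def using that by blast
  have BcycI: "path_and_cycle (X \<union> Y) R B" if "cyclic B q" "successively R p" "distinct (p @ q)" "set (p @ q) = X \<union> Y" for p q
    unfolding path_and_cycle_def using that by blast
  show ?case
  proof (cases "r = [] \<or> s = []")
    case True
    then show ?thesis
    proof
      assume "r = []"
      then show ?thesis using less.prems by (intro RcycI[of "[]" s]) (auto simp: cyclic_def)
    next
      assume "s = []"
      then show ?thesis using less.prems by (intro BcycI[of "[]" r]) (auto simp: cyclic_def)
    qed
  next
    case False
    define x1 y1 where "x1 = hd r" and "y1 = last r"
    have x1: "x1 \<in> X" and y1: "y1 \<in> Y" using less.prems False x1_def y1_def by auto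
    have "\<exists>r'. r = x1 # r' @ [y1]"
      using False x1 y1 disj x1_def y1_def
      by (cases r; cases "tl r" rule: rev_cases) auto
    then obtain r' where r: "r = x1 # r' @ [y1]" by blast
    define x2 y2 where "x2 = hd s" and "y2 = last s"
    have x2: "x2 \<in> X" and y2: "y2 \<in> Y" using less.prems False x2_def y2_def by auto
    have "\<exists>s'. s = x2 # s' @ [y2]"
      using False x2 y2 disj x2_def y2_def
      by (cases s; cases "tl s" rule: rev_cases) auto
    then obtain s' where s: "s = x2 # s' @ [y2]" by blast
    have Rr': "successively R r'" and Bs': "successively B s'"
      using less.prems(3,4) by (auto simp: r s successively_Cons successively_append_iff)
    have s'_ends: "s' = [] \<or> hd s' \<in> Y \<and> last s' \<in> X"
      using less.prems(4) B_bip[of x2 "hd s'"] B_bip[of "last s'" y2] x2 y2 disj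
      by (cases "s' = []") (auto simp: s successively_Cons successively_append_iff)
    \<comment> \<open>What remains of \<open>s\<close> runs from \<open>Y\<close> to
      \<open>X\<close> and is therefore reversed.\<close>
    have IH: "path_and_cycle (X \<union> Y) R B" if "r'' = [x2, y2] @ r \<or> r'' = r @ [x2, y2]" "successively R r''" for r''
    proof (rule less.hyps[of "rev s'" r''])
      show "length (rev s') < length s" by (simp add: s)
      show "distinct (r'' @ rev s')" "set (r'' @ rev s') = X \<union> Y"
        using less.prems(1,2) that(1) by (auto simp: s)
      show "successively R r''" by fact
      show "successively B (rev s')" using Bs' B_rev by simp
      show "r'' = [] \<or> hd r'' \<in> X \<and> last r'' \<in> Y" using that(1) x1 y1 x2 y2 r by auto
      show "rev s' = [] \<or> hd (rev s') \<in> X \<and> last (rev s') \<in> Y"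
        using s'_ends by (auto simp: hd_rev last_rev)
    qed
    show ?thesis
    proof (cases "R y1 x1 \<or> B y2 x2")
      case True
      then show ?thesis
      proof
        assume "R y1 x1"
        then show ?thesis using less.prems
          by (intro RcycI[of r s]) (auto simp: cyclic_def x1_def y1_def)
      next
        assume "B y2 x2"
        then show ?thesis using less.prems
          by (intro BcycI[of s r]) (auto simp: cyclic_def x2_def y2_def)
      qed
    next
      case False
      \<comment> \<open>The closing edge of each path has the colour of the other path.\<close>
      then have b1: "B x1 y1" and r2: "R x2 y2" "R y2 x2"
        using R_or_B[OF x1 y1] R_or_B[OF x2 y2] R_sym B_sym by blast+
      show ?thesis
      proof (cases "R y2 x1")
        case True
        then have "successively R ([x2, y2] @ r)" using r2 less.prems(3) by (simp add: r)
        then show ?thesis using IH by blast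
      next
        case False
        then have b2: "B y2 x1" using R_or_B'[OF y2 x1] by blast
        show ?thesis
        proof (cases "R y1 x2")
          case True
          then have "successively R (r @ [x2, y2])" using r2 less.prems(3)
            by (simp add: y1_def successively_append_iff)
          then show ?thesis using IH by blast
        next
          case False
          then have b3: "B y1 x2" using R_or_B'[OF y1 x2] by blast
          \<comment> \<open>Both edges between ends of different paths are blue here: one appends
            \<open>x1\<close>, \<open>y1\<close> to \<open>s\<close>, the other closes the cycle,
            and the interior \<open>r'\<close> is the red path.\<close>
          have "successively B (s @ [x1, y1])" using b1 b2 less.prems(4)
            by (simp add: y2_def successively_append_iff)
          then have "cyclic B (s @ [x1, y1])" using b3 by (simp add: s cyclic_def)
          then show ?thesis using less.prems(1,2) Rr'
            by (intro BcycI[of "s @ [x1, y1]" r']) (auto simp: r)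
        qed
      qed
    qed
  qed
qed

lemma mixed_ends_path_and_cycle:
  assumes "distinct (r @ s)" "set (r @ s) = X \<union> Y" "successively R r" "successively B s"
    "r = [] \<or> (hd r \<in> X) \<noteq> (last r \<in> X)" "s = [] \<or> (hd s \<in> X) \<noteq> (last s \<in> X)"
  shows "path_and_cycle (X \<union> Y) R B"
proof -
  have orient: "\<exists>p'. set p' = set p \<and> distinct p' \<and> (p' = p \<or> p' = rev p) \<and>
      (p' = [] \<or> hd p' \<in> X \<and> last p' \<in> Y)"
    if "p = [] \<or> (hd p \<in> X) \<noteq> (last p \<in> X)" "distinct p" "set p \<subseteq> X \<union> Y" for p
  proof (cases "p = []")
    case False
    then have "hd p \<in> X \<union> Y" "last p \<in> X \<union> Y" using that(3) by (meson hd_in_set last_in_set subsetD)+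
    then show ?thesis using that(1,2) False
      by (intro exI[of _ "if hd p \<in> X then p else rev p"]) (auto simp: hd_rev last_rev)
  qed auto
  have sub: "set r \<subseteq> X \<union> Y" "set s \<subseteq> X \<union> Y" "distinct r" "distinct s" using assms(1,2) by auto
  obtain r' where r': "set r' = set r" "distinct r'" "r' = r \<or> r' = rev r"
      "r' = [] \<or> hd r' \<in> X \<and> last r' \<in> Y"
    using orient[OF assms(5) sub(3,1)] by blast
  obtain s' where s': "set s' = set s" "distinct s'" "s' = s \<or> s' = rev s"
      "s' = [] \<or> hd s' \<in> X \<and> last s' \<in> Y"
    using orient[OF assms(6) sub(4,2)] by blast
  show ?thesis
  proof (rule even_path_and_cycle[of r' s'])
    show "successively R r'" using r'(3) assms(3) R_rev by blast
    show "successively B s'" using s'(3) assms(4) B_rev by blast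
    show "distinct (r' @ s')" "set (r' @ s') = X \<union> Y"
      using r'(1,2) s'(1,2) assms(1,2) by auto
  qed (fact r'(4), fact s'(4))
qed

text \<open>If both paths are non-empty, counting sides leaves two possibilities: each path has its
  ends on different sides, or \<open>r\<close> has both ends on one side and \<open>s\<close> both
  on the other. In the second case the edge between the two heads, whatever its colour, carries one
  head over to the other path, which repairs both.\<close>

lemma path_and_cycle_if_two_paths:
  assumes "two_paths (X \<union> Y) R B"
  shows "path_and_cycle (X \<union> Y) R B"
proof -
  obtain r s where rs: "distinct (r @ s)" "set (r @ s) = X \<union> Y" "successively R r" "successively B s"
    using assms by (auto simp: two_paths_def)
  show ?thesis
  proof (cases "r = [] \<or> s = []")
    case True
    then show ?thesis
    proof
      assume "r = []"
      then show ?thesis unfolding path_and_cycle_def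
        by (intro exI[of _ s] exI[of _ "[]"]) (use rs in \<open>auto simp: cyclic_def\<close>)
    next
      assume "s = []"
      then show ?thesis unfolding path_and_cycle_def
        by (intro exI[of _ r] exI[of _ "[]"]) (use rs in \<open>auto simp: cyclic_def\<close>)
    qed
  next
    case False
    then have ne: "r \<noteq> []" "s \<noteq> []" by auto
    have sub: "set r \<subseteq> X \<union> Y" "set s \<subseteq> X \<union> Y" using rs by auto
    then have ends: "hd r \<in> X \<union> Y" "last r \<in> X \<union> Y" "hd s \<in> X \<union> Y" "last s \<in> X \<union> Y"
      using ne by (meson hd_in_set last_in_set subsetD)+
    have br: "card (set r \<inter> X) + of_bool (last r \<in> Y) = card (set r \<inter> Y) + of_bool (hd r \<in> X)"
      using path_balance rs ne sub by auto
    interpret sw: bicoloured X Y B R by (rule swap_colours)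
    have bs: "card (set s \<inter> X) + of_bool (last s \<in> Y) = card (set s \<inter> Y) + of_bool (hd s \<in> X)"
      using sw.path_balance rs ne sub by auto
    have "card (set r \<inter> X) + card (set s \<inter> X) = card (set r \<inter> Y) + card (set s \<inter> Y)"
      using card_Int_parts[of X "set r" "set s" "{}"] card_Int_parts[of Y "set r" "set s" "{}"]
        rs(1,2) card_eq by auto
    \<comment> \<open>Adding \<open>path_balance\<close> for both paths cancels the vertex counts
      and leaves a condition on the four ends.\<close>
    then have bal: "of_bool (last r \<in> Y) + of_bool (last s \<in> Y) =
        (of_bool (hd r \<in> X) + of_bool (hd s \<in> X) :: nat)"
      using br bs by linarith
    have XY: "hd r \<in> Y \<longleftrightarrow> hd r \<notin> X" "last r \<in> Y \<longleftrightarrow> last r \<notin> X"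
      "hd s \<in> Y \<longleftrightarrow> hd s \<notin> X" "last s \<in> Y \<longleftrightarrow> last s \<notin> X" using ends disj by auto
    show ?thesis
    proof (cases "(hd r \<in> X) = (last r \<in> X)")
      case False
      then have "(hd s \<in> X) \<noteq> (last s \<in> X)" using bal XY
        by (cases "hd r \<in> X"; cases "hd s \<in> X"; cases "last s \<in> X") simp_all
      then show ?thesis using mixed_ends_path_and_cycle rs False by blast
    next
      case True
      then have e: "(hd s \<in> X) = (last s \<in> X)" "(hd s \<in> X) = (hd r \<notin> X)"
        using bal XY by (cases "hd r \<in> X"; cases "hd s \<in> X"; cases "last s \<in> X"; simp_all)+
      show ?thesis
      proof (cases "R (hd s) (hd r)")
        case R: True
        obtain y s' where s: "s = y # s'" using ne by (cases s) auto
        \<comment> \<open>Dropping the head moves that end to the other side, so the shortened path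
          is empty or has ends on different sides.\<close>
        have "s' = [] \<or> (hd s' \<in> X) \<noteq> (hd s \<in> X)"
          using rs(4) B_bip[of y "hd s'"] disj by (auto simp: s successively_Cons)
        then have "s' = [] \<or> (hd s' \<in> X) \<noteq> (last s' \<in> X)"
          using e(1) unfolding s by (cases "s' = []") auto
        moreover have "distinct ((y # r) @ s')" "set ((y # r) @ s') = X \<union> Y"
          using rs(1,2) by (auto simp: s)
        moreover have "successively R (y # r)" "successively B s'"
          using rs(3,4) R by (auto simp: s successively_Cons)
        moreover have "(hd (y # r) \<in> X) \<noteq> (last (y # r) \<in> X)" using e(2) True ne(1) by (simp add: s)
        ultimately show ?thesis using mixed_ends_path_and_cycle[of "y # r" s'] by blast
      next
        case False
        then have b: "B (hd r) (hd s)" 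
          using R_or_B[of "hd r" "hd s"] R_or_B'[of "hd r" "hd s"] R_sym e(2) XY by blast
        obtain y r' where r: "r = y # r'" using ne by (cases r) auto
        have "r' = [] \<or> (hd r' \<in> X) \<noteq> (hd r \<in> X)"
          using rs(3) R_bip[of y "hd r'"] disj by (auto simp: r successively_Cons)
        then have "r' = [] \<or> (hd r' \<in> X) \<noteq> (last r' \<in> X)"
          using True unfolding r by (cases "r' = []") auto
        moreover have "distinct (r' @ (y # s))" "set (r' @ (y # s)) = X \<union> Y"
          using rs(1,2) by (auto simp: r)
        moreover have "successively R r'" "successively B (y # s)"
          using rs(3,4) b by (auto simp: r successively_Cons)
        moreover have "(hd (y # s) \<in> X) \<noteq> (last (y # s) \<in> X)" using e ne(2) by (auto simp: r)
        ultimately show ?thesis using mixed_ends_path_and_cycle[of r' "y # s"] by blast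
      qed
    qed
  qed
qed

end

section \<open>Joining two blue bicliques by a chord of a red cycle\<close>

lemma cyclic_rotate: "cyclic E (p @ q) \<Longrightarrow> cyclic E (q @ p)"
proof (cases "p = [] \<or> q = []")
  case False
  then have "\<not> length (p @ q) \<le> 1" by (cases p; cases q) auto
  then show "cyclic E (p @ q) \<Longrightarrow> cyclic E (q @ p)"
    using False unfolding cyclic_def successively_append_iff by simp
qed auto

context bicoloured
begin

lemma cyclic_R_rev: "cyclic R p \<Longrightarrow> cyclic R (rev p)"
  using R_sym by (auto simp: cyclic_def R_rev hd_rev last_rev simp del: successively_rev)

text \<open>The edge between \<open>x\<close> and \<open>y\<close> links a path through
  \<open>PX\<close> and \<open>DY\<close> that starts at \<open>x\<close> to one through
  \<open>PY\<close> and \<open>DX\<close> that starts at \<open>y\<close>. Only one end of each is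
  prescribed, so a surplus of one is harmless.\<close>

lemma blue_double_biclique:
  assumes "PX \<subseteq> X" "PY \<subseteq> Y" "DX \<subseteq> X" "DY \<subseteq> Y" "PX \<inter> DX = {}" "PY \<inter> DY = {}"
    and "x \<in> PX" "y \<in> PY" "B x y"
    and "card PX = card DY \<or> card PX = Suc (card DY)" "card PY = card DX \<or> card PY = Suc (card DX)"
    and PX_DY: "\<And>u v. u \<in> PX \<Longrightarrow> v \<in> DY \<Longrightarrow> B u v" and PY_DX: "\<And>u v. u \<in> PY \<Longrightarrow> v \<in> DX \<Longrightarrow> B u v"
  shows "\<exists>s. distinct s \<and> set s = PX \<union> PY \<union> DX \<union> DY \<and> successively B s"
proof -
  have finite: "finite PX" "finite PY" "finite DX" "finite DY"
    using assms(1-4) fin by (auto intro: finite_subset)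
  have disjoint: "PX \<inter> DY = {}" "PY \<inter> DX = {}" "PX \<inter> PY = {}" "DX \<inter> DY = {}"
    using assms(1-4) disj by blast+
  have "\<exists>p. distinct p \<and> set p = PX \<union> DY \<and> successively B p \<and> p \<noteq> [] \<and> hd p = x"
    by (rule biclique_path_from) (use assms(7,10) finite disjoint PX_DY B_sym in blast)+
  then obtain p where p: "distinct p" "set p = PX \<union> DY" "successively B p" "p \<noteq> []" "hd p = x"
    by blast
  have "\<exists>p. distinct p \<and> set p = PY \<union> DX \<and> successively B p \<and> p \<noteq> [] \<and> hd p = y"
    by (rule biclique_path_from) (use assms(8,11) finite disjoint PY_DX B_sym in blast)+
  then obtain q where q: "distinct q" "set q = PY \<union> DX" "successively B q" "q \<noteq> []" "hd q = y"
    by blast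
  have "successively B (rev p @ q)"
    using p q assms(9) B_rev by (simp add: successively_append_iff last_rev del: successively_rev)
  moreover have "distinct (rev p @ q)" using p q disjoint assms(5,6) by auto
  moreover have "set (rev p @ q) = PX \<union> PY \<union> DX \<union> DY" using p q by auto
  ultimately show ?thesis by blast
qed

end

text \<open>\<open>Z\<close> is the vertex set of the red cycle. The sizes are such that moving one or two vertices of each
  side from \<open>Z\<close> to \<open>SX\<close> and \<open>SY\<close> makes the two blue bicliques traceable.\<close>
locale blue_frame = bicoloured X Y R B for X Y :: "'a set" and R B +
  fixes Z SX SY DX DY :: "'a set"
  assumes union: "Z \<union> SX \<union> SY \<union> DX \<union> DY = X \<union> Y"
    and Z_disjoint: "Z \<inter> (SX \<union> SY \<union> DX \<union> DY) = {}"
    and sides: "SX \<subseteq> X" "DX \<subseteq> X" "SY \<subseteq> Y" "DY \<subseteq> Y"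
    and S_D: "SX \<inter> DX = {}" "SY \<inter> DY = {}"
    and cards: "Suc (card SX) = card DY" "Suc (card SY) = card DX"
    and blue_DY: "u \<in> SX \<union> (Z \<inter> X) \<Longrightarrow> v \<in> DY \<Longrightarrow> B u v"
    and blue_DX: "u \<in> SY \<union> (Z \<inter> Y) \<Longrightarrow> v \<in> DX \<Longrightarrow> B u v"
begin

text \<open>The blue edge between \<open>x\<close> and \<open>y\<close> joins the bicliques enlarged
  by \<open>PX\<close> and \<open>PY\<close>; the rest of the cycle has to be traced by
  \<open>r\<close>.\<close>

lemma two_paths_by_deletion:
  assumes "PX \<subseteq> Z \<inter> X" "PY \<subseteq> Z \<inter> Y" "x \<in> PX" "y \<in> PY" "B x y"
    and "card PX = 1 \<or> card PX = 2" "card PY = 1 \<or> card PY = 2"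
    and "distinct r" "successively R r" "set r = Z - PX - PY"
  shows "two_paths (X \<union> Y) R B"
proof -
  have finite: "finite SX" "finite SY" "finite PX" "finite PY"
    using sides assms(1,2) fin by (auto intro: finite_subset)
  have "SX \<inter> PX = {}" "SY \<inter> PY = {}" using Z_disjoint assms(1,2) by blast+
  then have card: "card (SX \<union> PX) = card SX + card PX" "card (SY \<union> PY) = card SY + card PY"
    using finite card_Un_disjoint by blast+
  have "\<exists>s. distinct s \<and> set s = (SX \<union> PX) \<union> (SY \<union> PY) \<union> DX \<union> DY \<and> successively B s"
  proof (rule blue_double_biclique)
    show "(SX \<union> PX) \<inter> DX = {}" "(SY \<union> PY) \<inter> DY = {}" using assms(1,2) Z_disjoint S_D by blast+
    show "card (SX \<union> PX) = card DY \<or> card (SX \<union> PX) = Suc (card DY)"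
      "card (SY \<union> PY) = card DX \<or> card (SY \<union> PY) = Suc (card DX)"
      using card cards assms(6,7) by auto
    show "B u v" if "u \<in> SX \<union> PX" "v \<in> DY" for u v using that assms(1) blue_DY by blast
    show "B u v" if "u \<in> SY \<union> PY" "v \<in> DX" for u v using that assms(2) blue_DX by blast
  qed (use sides assms(1-5) in auto)
  then obtain s where s: "distinct s" "set s = (SX \<union> PX) \<union> (SY \<union> PY) \<union> DX \<union> DY" "successively B s"
    by blast
  show ?thesis
  proof (rule two_pathsI[of r s])
    show "set r \<inter> set s = {}" using assms(10) s(2) Z_disjoint by blast
    show "set r \<union> set s = X \<union> Y" using assms(1,2,10) s(2) union by blast
  qed (use assms s in auto)
qed

text \<open>Induction on the arc \<open>A\<close> cut off by the chord. Two shorter chords inside or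
  next to the arc are examined: a blue one is left to the induction hypothesis, while two red ones
  give a detour around \<open>x\<close> and \<open>y\<close>.\<close>

lemma two_paths_by_chord:
  assumes "distinct z" "set z = Z" "cyclic R z" "z = x # A @ y # C" "B x y"
  shows "two_paths (X \<union> Y) R B"
  using assms
proof (induction "length A" arbitrary: z x A y C rule: less_induct)
  case less
  \<comment> \<open>The case \<open>x \<in> X\<close>, for any arc as long as \<open>A\<close>, so
    that it also applies to the reversed cycle.\<close>
  have step: "two_paths (X \<union> Y) R B"
    if z: "distinct z" "set z = Z" "cyclic R z" "z = x # A' @ y # C" and "B x y"
      and x: "x \<in> X" and len: "length A' = length A" for z x A' y C
  proof -
    have y: "y \<in> Y" using B_bip[OF \<open>B x y\<close>] x disj by blast
    have red: "successively R (x # A' @ [y])" "successively R C" "C = [] \<or> R y (hd C) \<and> R (last C) x"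
      "C = [] \<longrightarrow> R y x"
    proof -
      have "cyclic R ((x # A' @ [y]) @ C)" using z(3,4) by simp
      then show "successively R (x # A' @ [y])" "successively R C" "C = [] \<or> R y (hd C) \<and> R (last C) x"
        "C = [] \<longrightarrow> R y x"
        unfolding cyclic_def successively_append_iff by auto
    qed
    \<comment> \<open>With \<open>C\<close> empty, the closing edge of the cycle would make the
      chord red.\<close>
    have "C \<noteq> []" using red(4) \<open>B x y\<close> not_R_B R_sym by blast
    then obtain g C1 where C: "C = g # C1" by (cases C) auto
    have A'_ne: "A' \<noteq> []" using red(1) \<open>B x y\<close> not_R_B by (cases A') auto
    \<comment> \<open>The ends \<open>x\<close> and \<open>y\<close> lie on different sides; being
      non-empty, the arc thus has at least two vertices.\<close>
    have even: "even (length A')" using last_side[OF red(1)] x y disj by (auto split: if_splits)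
    obtain a A1 where A1: "A' = a # A1" using A'_ne by (cases A') auto
    have "A1 \<noteq> []" using even A1 by auto
    then obtain A2 e where A2: "A1 = A2 @ [e]" by (cases A1 rule: rev_cases) auto
    have A': "A' = a # A2 @ [e]" using A1 A2 by simp
    have edges: "R x a" "R e y" "R y g"
      using red A' C by (auto simp: successively_append_iff successively_Cons)
    have sides': "a \<in> Y" "e \<in> X" "g \<in> X"
      using edges(1-3) x y R_bip disj by blast+
    show ?thesis
    proof (cases A2 rule: rev_cases)
      \<comment> \<open>A chord of length 3: delete the four vertices it spans instead of only its ends.\<close>
      case Nil
      then have zz: "z = x # a # e # y # C" using z A' by simp
      show ?thesis
      proof (rule two_paths_by_deletion[of "{x, e}" "{a, y}" x y C])
        show "set C = Z - {x, e} - {a, y}" using z(1,2) zz by auto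
        show "{x, e} \<subseteq> Z \<inter> X" "{a, y} \<subseteq> Z \<inter> Y" using z(2) zz x y sides' by auto
        show "card {x, e} = 1 \<or> card {x, e} = 2" "card {a, y} = 1 \<or> card {a, y} = 2"
          by (auto simp: card_insert_if)
      qed (use z(1) zz red(2) \<open>B x y\<close> in auto)
    next
      \<comment> \<open>\<open>a\<close>--\<open>e\<close> and \<open>f\<close>--\<open>g\<close> are shorter chords. If both are red, then the path that runs through \<open>C\<close>
        back to \<open>g\<close>, jumps to \<open>f\<close>, runs back to \<open>a\<close> and jumps to \<open>e\<close> misses only \<open>x\<close> and \<open>y\<close>.\<close>
      case (snoc A3 f)
      have zz: "z = x # a # A3 @ f # e # y # g # C1" using z(4) A' snoc C by simp
      have "successively R ([x] @ (a # A3 @ [f]) @ [e, y])" using red(1) A' snoc by simp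
      then have Rfe: "R f e" "successively R (a # A3 @ [f])"
        unfolding successively_append_iff by auto
      have f: "f \<in> Y" using R_bip[OF Rfe(1)] sides' disj by blast
      \<comment> \<open>Rotations of the same cycle that start at the chords from \<open>a\<close>
        to \<open>e\<close> and from \<open>f\<close> to \<open>g\<close>.\<close>
      have cyc1: "cyclic R (a # (A3 @ [f]) @ e # (y # g # C1 @ [x]))"
        using cyclic_rotate[of R "[x]" "a # A3 @ f # e # y # g # C1"] z(3) zz by simp
      have cyc2: "cyclic R (f # [e, y] @ g # (C1 @ x # a # A3))"
        using cyclic_rotate[of R "x # a # A3" "f # e # y # g # C1"] z(3) zz by simp
      show ?thesis
      proof (cases "B a e \<or> B f g")
        case True
        then show ?thesis
        proof
          assume "B a e"
          show ?thesis
            by (rule less.hyps[OF _ _ _ cyc1 refl \<open>B a e\<close>]) (use z(1,2) zz len A' snoc in auto)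
        next
          assume "B f g"
          have "length A3 > 0" using even A' snoc by (cases A3) auto
          then show ?thesis
            by (intro less.hyps[OF _ _ _ cyc2 refl \<open>B f g\<close>]) (use z(1,2) zz len A' snoc in auto)
        qed
      next
        case False
        then have "R a e" "R f g" using R_or_B' sides' f by blast+
        moreover define P where "P = rev (a # A3 @ [f])"
        have "successively R P" "successively R (rev C)"
          unfolding P_def using Rfe(2) red(2) R_rev by blast+
        moreover have "P \<noteq> []" "hd P = f" "last P = a" "last (rev C) = g" by (auto simp: P_def C)
        ultimately have "successively R (rev C @ P @ [e])"
          using R_sym[of f g] by (simp add: successively_append_iff del: successively_rev)
        moreover have "distinct (rev C @ P @ [e])" "set (rev C @ P @ [e]) = Z - {x} - {y}"
        proof -
          show "distinct (rev C @ P @ [e])" using z(1) unfolding zz by (auto simp: P_def C)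
          have "set (rev C @ P @ [e]) = set z - {x} - {y}"
            using z(1) unfolding zz by (auto simp: P_def C)
          then show "set (rev C @ P @ [e]) = Z - {x} - {y}" using z(2) by simp
        qed
        moreover have "{x} \<subseteq> Z \<inter> X" "{y} \<subseteq> Z \<inter> Y" using z(2,4) x y by auto
        ultimately show ?thesis
          using two_paths_by_deletion[of "{x}" "{y}" x y "rev C @ P @ [e]"] \<open>B x y\<close> by simp
      qed
    qed
  qed
  show ?case
  proof (cases "x \<in> X")
    case True
    then show ?thesis using step less.prems by blast
  next
    case False
    then have "y \<in> X" using B_bip[OF less.prems(5)] by blast
    \<comment> \<open>Traversing the cycle backwards exchanges \<open>x\<close> and \<open>y\<close>
      and keeps the length of the arc.\<close>
    moreover have "cyclic R (y # rev A @ x # rev C)"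
      using cyclic_rotate[of R "rev C" "y # rev A @ [x]"] cyclic_R_rev[OF less.prems(3)] less.prems(4)
      by simp
    moreover have "distinct (y # rev A @ x # rev C)" "set (y # rev A @ x # rev C) = Z"
      using less.prems(1,2,4) by auto
    ultimately show ?thesis using step[OF _ _ _ refl] less.prems(5) B_sym by (metis length_rev)
  qed
qed

end

section \<open>The final state of the depth-first search\<close>

text \<open>\<open>cards\<close> compares opposite sides because the blue bicliques run between
  \<open>D \<inter> X\<close> and \<open>U \<inter> Y\<close>, and between
  \<open>D \<inter> Y\<close> and \<open>U \<inter> X\<close>; it makes both balanced.\<close>

locale dfs_state = bicoloured X Y R B for X Y :: "'a set" and R B +
  fixes p :: "'a list" and D U :: "'a set"
  assumes p_distinct: "distinct p" and p_red: "successively R p"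
    and union: "set p \<union> D \<union> U = X \<union> Y"
    and disjoint: "set p \<inter> D = {}" "set p \<inter> U = {}" "D \<inter> U = {}"
    and D_U: "d \<in> D \<Longrightarrow> u \<in> U \<Longrightarrow> \<not> R d u"
    and cards: "card (U \<inter> X) = card (D \<inter> Y)" "card (U \<inter> Y) = card (D \<inter> X)"
begin

lemma finite_DU: "finite D" "finite U"
  using union fin by (metis finite_Un)+

lemma blue_D_U:
  "x \<in> D \<inter> X \<Longrightarrow> y \<in> U \<inter> Y \<Longrightarrow> B x y" "x \<in> U \<inter> X \<Longrightarrow> y \<in> D \<inter> Y \<Longrightarrow> B x y"
  using R_or_B D_U R_sym by blast+

text \<open>A blue walk through an initial or final segment \<open>m\<close> of \<open>p\<close> (possibly empty, when \<open>b\<close> and \<open>a\<close> are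
  adjacent) joins the two blue bicliques.\<close>
lemma two_paths_by_joining:
  assumes "b \<in> (D \<inter> X) \<union> (U \<inter> Y)" "a \<in> (D \<inter> Y) \<union> (U \<inter> X)"
    and "successively B (b # m @ [a])" "p = m @ p' \<or> p = p' @ m"
  shows "two_paths (X \<union> Y) R B"
proof -
  have E: "\<And>x y. x \<in> D \<inter> X \<Longrightarrow> y \<in> U \<inter> Y \<Longrightarrow> B x y \<and> B y x"
    "\<And>x y. x \<in> D \<inter> Y \<Longrightarrow> y \<in> U \<inter> X \<Longrightarrow> B x y \<and> B y x"
    using blue_D_U B_sym by blast+
  have "\<exists>q. distinct q \<and> set q = (D \<inter> X) \<union> (U \<inter> Y) \<and> successively B q \<and> q \<noteq> [] \<and> hd q = b"
    using biclique_path_from[of "D \<inter> X" "U \<inter> Y" b B] biclique_path_from[of "U \<inter> Y" "D \<inter> X" b B]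
      E(1) assms(1) finite_DU cards disjoint(3) by (auto simp: Un_commute)
  then obtain q1 where q1: "distinct q1" "set q1 = (D \<inter> X) \<union> (U \<inter> Y)" "successively B q1" "q1 \<noteq> []" "hd q1 = b"
    by blast
  have "\<exists>q. distinct q \<and> set q = (D \<inter> Y) \<union> (U \<inter> X) \<and> successively B q \<and> q \<noteq> [] \<and> hd q = a"
    using biclique_path_from[of "D \<inter> Y" "U \<inter> X" a B] biclique_path_from[of "U \<inter> X" "D \<inter> Y" a B]
      E(2) assms(2) finite_DU cards disjoint(3) by (auto simp: Un_commute)
  then obtain q2 where q2: "distinct q2" "set q2 = (D \<inter> Y) \<union> (U \<inter> X)" "successively B q2" "q2 \<noteq> []" "hd q2 = a"
    by blast
  \<comment> \<open>As \<open>m\<close> is cut off at an end of \<open>p\<close>, the remainder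
    \<open>p'\<close> is still a red path.\<close>
  have m: "set p = set m \<union> set p'" "set m \<inter> set p' = {}" "distinct m" "distinct p'" "successively R p'"
    using assms(4) p_distinct p_red by (auto simp: successively_append_iff)
  have "successively B (rev q1 @ m @ q2)"
  proof (cases "m = []")
    case True
    then show ?thesis using assms(3) q1 q2 B_rev
      by (simp add: successively_append_iff last_rev del: successively_rev)
  next
    case False
    then have "successively B m" "B b (hd m)" "B (last m) a"
      using assms(3) by (auto simp: successively_append_iff successively_Cons)
    then show ?thesis using q1 q2 B_rev False
      by (simp add: successively_append_iff last_rev del: successively_rev)
  qed
  moreover have "distinct (rev q1 @ m @ q2)" using q1 q2 m disjoint disj by auto
  ultimately show ?thesis
    by (intro two_pathsI[of p' "rev q1 @ m @ q2"]) (use m q1 q2 union disjoint in auto)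
qed

lemma card_p: "card (set p \<inter> X) = card (set p \<inter> Y)"
  using card_Int_parts[of X "set p" D U] card_Int_parts[of Y "set p" D U]
    union disjoint finite_DU cards card_eq by simp

text \<open>\<open>D\<close> and \<open>U\<close> together meet both sides equally, hence so does
  \<open>p\<close>, and \<open>path_balance\<close> settles the ends.\<close>

lemma p_ends:
  assumes "p \<noteq> []"
  shows "hd p \<in> X \<and> last p \<in> Y \<or> hd p \<in> Y \<and> last p \<in> X"
proof -
  have "set p \<subseteq> X \<union> Y" using union by blast
  moreover from this have "hd p \<in> X \<union> Y" "last p \<in> X \<union> Y" using assms by (meson hd_in_set last_in_set subsetD)+
  ultimately show ?thesis using path_balance[OF p_red assms p_distinct] card_p disj by (auto split: if_splits)
qed

end

section \<open>Red bicliques on the finished and on the unvisited vertices\<close>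

text \<open>A split colouring encoded by one set: on each side, \<open>D\<close> cuts out one class
  and its complement the other.\<close>

definition split_by :: "'a set \<Rightarrow> 'a set \<Rightarrow> ('a \<Rightarrow> 'a \<Rightarrow> bool) \<Rightarrow> 'a set \<Rightarrow> bool" where
  "split_by X Y R D \<longleftrightarrow> D \<inter> X \<noteq> {} \<and> D \<inter> Y \<noteq> {} \<and> X - D \<noteq> {} \<and> Y - D \<noteq> {} \<and>
     (\<forall>x\<in>X. \<forall>y\<in>Y. R x y \<longleftrightarrow> (x \<in> D \<longleftrightarrow> y \<in> D))"

text \<open>The case in which no blue edge inside \<open>D\<close> or inside \<open>U\<close> joins
  the two blue bicliques.\<close>

locale red_dfs_state = dfs_state +
  assumes nonempty: "D \<inter> X \<noteq> {}" "D \<inter> Y \<noteq> {}"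
    and red_D: "x \<in> D \<inter> X \<Longrightarrow> y \<in> D \<inter> Y \<Longrightarrow> R x y"
    and red_U: "x \<in> U \<inter> X \<Longrightarrow> y \<in> U \<inter> Y \<Longrightarrow> R x y"
begin

lemma nonempty_U: "U \<inter> X \<noteq> {}" "U \<inter> Y \<noteq> {}"
  using nonempty cards finite_DU by (metis card_0_eq card.empty finite_Int)+

text \<open>This symmetry, together with those in the sides and in the direction of
  \<open>p\<close>, lets the arguments below treat one orientation only.\<close>

lemma swap_D_U: "red_dfs_state X Y R B p U D"
proof
  show "\<not> R d u" if "d \<in> U" "u \<in> D" for d u using that D_U R_sym by blast
qed (use p_distinct p_red union disjoint cards nonempty_U red_D red_U in auto)

lemma swap_X_Y: "red_dfs_state Y X R B p D U"
proof -
  interpret sw: bicoloured Y X R B by (rule swap_sides)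
  show ?thesis
  proof
    show "\<not> R d u" if "d \<in> D" "u \<in> U" for d u using that D_U by blast
    show "R x y" if "x \<in> D \<inter> Y" "y \<in> D \<inter> X" for x y using that red_D R_sym by blast
    show "R x y" if "x \<in> U \<inter> Y" "y \<in> U \<inter> X" for x y using that red_U R_sym by blast
  qed (use p_distinct p_red union disjoint cards nonempty in auto)
qed

lemma rev_p: "red_dfs_state X Y R B (rev p) D U"
proof
  show "\<not> R d u" if "d \<in> D" "u \<in> U" for d u using that D_U by blast
  show "successively R (rev p)" using p_red R_rev by blast
qed (use p_distinct union disjoint cards nonempty red_D red_U in auto)

text \<open>A balanced piece of the red biclique on \<open>D\<close>, to be attached to a red path
  at \<open>d\<close>.\<close>

lemma red_block:
  assumes "d \<in> D \<inter> X" "1 \<le> m" "m \<le> card (D \<inter> X)" "m \<le> card (D \<inter> Y)"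
  shows "\<exists>q. distinct q \<and> successively R q \<and> q \<noteq> [] \<and> set q \<subseteq> D \<and> card (set q \<inter> X) = m \<and>
     card (set q \<inter> Y) = m \<and> hd q = d \<and> last q \<in> D \<inter> Y"
proof -
  obtain S where S: "S \<subseteq> D \<inter> X" "card S = m" "d \<in> S"
    using obtain_subset_containing[of "D \<inter> X" d m] assms finite_DU by blast
  obtain t where t: "t \<in> D \<inter> Y" using nonempty by blast
  then obtain T where T: "T \<subseteq> D \<inter> Y" "card T = m" "t \<in> T"
    using obtain_subset_containing[of "D \<inter> Y" t m] assms finite_DU by blast
  have "\<exists>q. distinct q \<and> set q = S \<union> T \<and> successively R q \<and> q \<noteq> [] \<and> hd q = d \<and> last q = t"
  proof (rule biclique_path)
    show "finite S" "finite T" using S T finite_DU by (meson finite_Int finite_subset)+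
    show "R x y \<and> R y x" if "x \<in> S" "y \<in> T" for x y using that S T red_D R_sym by blast
  qed (use S T disj in auto)
  then obtain q where q: "distinct q" "set q = S \<union> T" "successively R q" "q \<noteq> []" "hd q = d" "last q = t"
    by blast
  have "set q \<inter> X = S" "set q \<inter> Y = T" using q(2) S T disj by blast+
  then show ?thesis using q S T t by blast
qed

text \<open>By the choice of \<open>m\<close>, removing \<open>T\<close> wipes out the smaller blue
  biclique and shrinks the other one evenly, so the latter still has a blue Hamiltonian
  path.\<close>

lemma two_paths_by_absorbing:
  assumes "distinct r" "successively R r" "set r = set p \<union> T" "T \<subseteq> D \<union> U"
    and m: "m = min (card (D \<inter> X)) (card (D \<inter> Y))"
    and "card (T \<inter> D \<inter> X) = m" "card (T \<inter> D \<inter> Y) = m" "card (T \<inter> U \<inter> X) = m" "card (T \<inter> U \<inter> Y) = m"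
  shows "two_paths (X \<union> Y) R B"
proof -
  have card: "card (W \<inter> S - T) = card (W \<inter> S) - card (T \<inter> W \<inter> S)" if "finite W" for W S
  proof -
    have "W \<inter> S - T = W \<inter> S - T \<inter> W \<inter> S" by blast
    then show ?thesis using that by (metis (no_types, lifting) card_Diff_subset finite_Int inf.cobounded2 inf_assoc)
  qed
  have fin': "finite (W \<inter> S - T)" if "W = D \<or> W = U" for W S using finite_DU that by blast
  have "\<exists>s. distinct s \<and> set s = (D \<union> U) - T \<and> successively B s"
  proof (cases "card (D \<inter> X) \<le> card (D \<inter> Y)")
    case True
    then have "card (D \<inter> X - T) = 0" "card (U \<inter> Y - T) = 0"
      using card finite_DU assms(6,9) m cards by auto
    then have "D \<inter> X - T = {}" "U \<inter> Y - T = {}" using fin' card_0_eq by blast+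
    then have "(D \<union> U) - T = (D \<inter> Y - T) \<union> (U \<inter> X - T)" using union by blast
    moreover have "\<exists>s. distinct s \<and> set s = (D \<inter> Y - T) \<union> (U \<inter> X - T) \<and> successively B s"
    proof (rule biclique_path_balanced)
      show "card (D \<inter> Y - T) = card (U \<inter> X - T)" using card finite_DU assms(7,8) cards by simp
      show "B x y \<and> B y x" if "x \<in> D \<inter> Y - T" "y \<in> U \<inter> X - T" for x y
        using that blue_D_U B_sym by blast
    qed (use finite_DU disjoint in auto)
    ultimately show ?thesis by simp
  next
    case False
    then have "card (D \<inter> Y - T) = 0" "card (U \<inter> X - T) = 0"
      using card finite_DU assms(7,8) m cards by auto
    then have "D \<inter> Y - T = {}" "U \<inter> X - T = {}" using fin' card_0_eq by blast+
    then have "(D \<union> U) - T = (D \<inter> X - T) \<union> (U \<inter> Y - T)" using union by blast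
    moreover have "\<exists>s. distinct s \<and> set s = (D \<inter> X - T) \<union> (U \<inter> Y - T) \<and> successively B s"
    proof (rule biclique_path_balanced)
      show "card (D \<inter> X - T) = card (U \<inter> Y - T)" using card finite_DU assms(6,9) cards by simp
      show "B x y \<and> B y x" if "x \<in> D \<inter> X - T" "y \<in> U \<inter> Y - T" for x y
        using that blue_D_U B_sym by blast
    qed (use finite_DU disjoint in auto)
    ultimately show ?thesis by simp
  qed
  then obtain s where s: "distinct s" "set s = (D \<union> U) - T" "successively B s" by blast
  show ?thesis
  proof (rule two_pathsI[of r s])
    show "set r \<inter> set s = {}" using assms(3) s(2) disjoint by blast
    show "set r \<union> set s = X \<union> Y" using assms(3,4) s(2) union by blast
  qed (use assms s in auto)
qed

text \<open>The common part of the next two lemmas: the last premise asks only how \<open>p\<close>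
  and one red block from each of \<open>D\<close> and \<open>U\<close> are strung together.\<close>

lemma two_paths_by_two_blocks:
  assumes "d \<in> D \<inter> X" "u \<in> U \<inter> Y"
    and "\<And>q1 q2. q1 \<noteq> [] \<Longrightarrow> q2 \<noteq> [] \<Longrightarrow> distinct q1 \<Longrightarrow> distinct q2 \<Longrightarrow> successively R q1 \<Longrightarrow> successively R q2 \<Longrightarrow>
       hd q1 = d \<Longrightarrow> last q1 \<in> D \<inter> Y \<Longrightarrow> hd q2 = u \<Longrightarrow> last q2 \<in> U \<inter> X \<Longrightarrow> set q1 \<subseteq> D \<Longrightarrow> set q2 \<subseteq> U \<Longrightarrow>
       \<exists>r. distinct r \<and> successively R r \<and> set r = set p \<union> set q1 \<union> set q2"
  shows "two_paths (X \<union> Y) R B"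
proof -
  define m where "m = min (card (D \<inter> X)) (card (D \<inter> Y))"
  have m: "1 \<le> m" "m \<le> card (D \<inter> X)" "m \<le> card (D \<inter> Y)"
    using nonempty finite_DU by (auto simp: m_def Suc_le_eq card_gt_0_iff)
  obtain q1 where q1: "distinct q1" "successively R q1" "q1 \<noteq> []" "set q1 \<subseteq> D" "card (set q1 \<inter> X) = m"
     "card (set q1 \<inter> Y) = m" "hd q1 = d" "last q1 \<in> D \<inter> Y"
    using red_block[OF assms(1) m] by blast
  \<comment> \<open>The block in \<open>U\<close> starts in \<open>Y\<close>, so it comes from
    \<open>red_block\<close> with both sides and both sets exchanged.\<close>
  interpret yx: red_dfs_state Y X R B p D U by (rule swap_X_Y)
  interpret s: red_dfs_state Y X R B p U D by (rule yx.swap_D_U)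
  obtain q2 where q2: "distinct q2" "successively R q2" "q2 \<noteq> []" "set q2 \<subseteq> U" "card (set q2 \<inter> X) = m"
     "card (set q2 \<inter> Y) = m" "hd q2 = u" "last q2 \<in> U \<inter> X"
    using s.red_block[OF assms(2) m(1)] m cards by auto
  obtain r where r: "distinct r" "successively R r" "set r = set p \<union> set q1 \<union> set q2"
    using assms(3)[of q1 q2] q1 q2 by blast
  have I: "(set q1 \<union> set q2) \<inter> D = set q1" "(set q1 \<union> set q2) \<inter> U = set q2"
    using q1(4) q2(4) disjoint by blast+
  show ?thesis
    by (rule two_paths_by_absorbing[OF r(1,2) _ _ m_def, of "set q1 \<union> set q2"])
      (use r(3) q1 q2 in \<open>auto simp only: I Un_assoc\<close>)
qed

text \<open>The path \<open>p\<close> leads from \<open>U\<close> to \<open>D\<close>, so a block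
  fits at each end.\<close>

lemma two_paths_by_bridge:
  assumes "p \<noteq> []" "u \<in> U \<inter> Y" "R (hd p) u" "d \<in> D \<inter> X" "R (last p) d"
  shows "two_paths (X \<union> Y) R B"
proof (rule two_paths_by_two_blocks[OF assms(4,2)])
  fix q1 q2
  assume q: "q1 \<noteq> []" "q2 \<noteq> []" "distinct q1" "distinct q2" "successively R q1" "successively R q2"
    "hd q1 = d" "hd q2 = u" "set q1 \<subseteq> D" "set q2 \<subseteq> U"
  have "successively R (rev q2 @ p @ q1)"
    using q assms(1,3,5) p_red R_rev R_sym
    by (simp add: successively_append_iff last_rev del: successively_rev)
  moreover have "distinct (rev q2 @ p @ q1)" using q disjoint p_distinct by auto
  moreover have "set (rev q2 @ p @ q1) = set p \<union> set q1 \<union> set q2" by auto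
  ultimately show "\<exists>r. distinct r \<and> successively R r \<and> set r = set p \<union> set q1 \<union> set q2" by blast
qed

text \<open>A block in \<open>U\<close> closes \<open>p\<close> to a red cycle, which is opened at
  \<open>v\<close> to continue into a block of \<open>D\<close>. The hypotheses cover all of
  \<open>U\<close> because the last vertex of the block is not under control.\<close>

lemma two_paths_by_cycle_exit:
  assumes "p \<noteq> []" "\<And>u. u \<in> U \<inter> Y \<Longrightarrow> R (hd p) u" "\<And>u. u \<in> U \<inter> X \<Longrightarrow> R (last p) u"
    and "v \<in> set p" "d \<in> D \<inter> X" "R v d"
  shows "two_paths (X \<union> Y) R B"
proof -
  obtain p1 p2 where p: "p = p1 @ p2" "p2 \<noteq> []" "hd p2 = v"
    using assms(4) by (metis list.sel(1) list.distinct(1) split_list)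
  obtain u where u: "u \<in> U \<inter> Y" using nonempty_U by blast
  show ?thesis
  proof (rule two_paths_by_two_blocks[OF assms(5) u])
    fix q1 q2
    assume q: "q1 \<noteq> []" "q2 \<noteq> []" "distinct q1" "distinct q2" "successively R q1" "successively R q2"
      "hd q1 = d" "hd q2 = u" "last q2 \<in> U \<inter> X" "set q1 \<subseteq> D" "set q2 \<subseteq> U"
    have "R (hd p) (hd q2)" "R (last p) (last q2)" using q assms(2,3) u by blast+
    moreover have "successively R p1" "successively R p2" "p1 = [] \<or> R (last p1) v"
      using p_red by (auto simp: p successively_append_iff)
    ultimately have "successively R (rev q1 @ p2 @ rev q2 @ p1)"
      using q assms(6) R_rev R_sym
      by (cases "p1 = []") (simp_all add: p successively_append_iff last_rev hd_rev del: successively_rev)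
    moreover have "distinct (rev q1 @ p2 @ rev q2 @ p1)"
      using q disjoint p_distinct by (auto simp: p)
    moreover have "set (rev q1 @ p2 @ rev q2 @ p1) = set p \<union> set q1 \<union> set q2" by (auto simp: p)
    ultimately show "\<exists>r. distinct r \<and> successively R r \<and> set r = set p \<union> set q1 \<union> set q2" by blast
  qed
qed

lemma split_by_D:
  assumes "\<And>v d. v \<in> set p \<Longrightarrow> d \<in> D \<Longrightarrow> \<not> R v d"
    and "\<And>x y. x \<in> (set p \<union> U) \<inter> X \<Longrightarrow> y \<in> (set p \<union> U) \<inter> Y \<Longrightarrow> R x y"
  shows "split_by X Y R D"
  unfolding split_by_def
proof (intro conjI ballI)
  show "X - D \<noteq> {}" "Y - D \<noteq> {}" using nonempty_U disjoint by blast+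
  fix x y assume xy: "x \<in> X" "y \<in> Y"
  then have mem: "x \<in> D \<or> x \<in> set p \<union> U" "y \<in> D \<or> y \<in> set p \<union> U" using union by blast+
  have no: "\<not> R v d" "\<not> R d v" if "v \<in> set p \<union> U" "d \<in> D" for v d
    using that assms(1) D_U R_sym by blast+
  show "R x y \<longleftrightarrow> (x \<in> D \<longleftrightarrow> y \<in> D)"
  proof (cases "x \<in> D")
    case True
    then show ?thesis using xy red_D[of x y] no(2)[of y x] mem(2) by blast
  next
    case False
    then show ?thesis using xy assms(2)[of x y] no(1)[of x y] mem disjoint by blast
  qed
qed (use nonempty in auto)

lemma two_paths_or_split_if_cycle:
  assumes "p \<noteq> []" "hd p \<in> X" "last p \<in> Y"
    and hd: "\<And>u. u \<in> U \<inter> Y \<Longrightarrow> R (hd p) u" and last: "\<And>u. u \<in> U \<inter> X \<Longrightarrow> R (last p) u"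
  shows "two_paths (X \<union> Y) R B \<or> split_by X Y R D"
proof (cases "\<exists>v\<in>set p. \<exists>d\<in>D. R v d")
  case True
  then obtain v d where vd: "v \<in> set p" "d \<in> D" "R v d" by blast
  show ?thesis
  proof (cases "d \<in> X")
    case True
    then show ?thesis using two_paths_by_cycle_exit[of v d] assms vd by blast
  next
    case False
    interpret yx: red_dfs_state Y X R B p D U by (rule swap_X_Y)
    \<comment> \<open>Exchanging the sides also exchanges the roles of the ends of \<open>p\<close>,
      hence the reversal.\<close>
    interpret r: red_dfs_state Y X R B "rev p" D U by (rule yx.rev_p)
    have "d \<in> D \<inter> Y" using False vd union by blast
    then have "two_paths (Y \<union> X) R B"
      using r.two_paths_by_cycle_exit[of v d] assms vd by (simp add: hd_rev last_rev)
    then show ?thesis by (simp add: Un_commute)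
  qed
next
  case no_exit: False
  show ?thesis
  proof (cases "\<exists>x\<in>(set p \<union> U) \<inter> X. \<exists>y\<in>(set p \<union> U) \<inter> Y. \<not> R x y")
    case False
    then show ?thesis using split_by_D no_exit by blast
  next
    case True
    then obtain x y where xy: "x \<in> (set p \<union> U) \<inter> X" "y \<in> (set p \<union> U) \<inter> Y" "\<not> R x y" by blast
    then have "B x y" using R_or_B by blast
    \<comment> \<open>If an end of the blue edge lies in \<open>U\<close>, it is itself taken into
      the cycle; the edge is then a chord in every case.\<close>
    obtain ux where ux: "ux \<in> U \<inter> X" "x \<in> U \<longrightarrow> ux = x" using nonempty_U xy(1) by blast
    obtain uy where uy: "uy \<in> U \<inter> Y" "y \<in> U \<longrightarrow> uy = y" using nonempty_U xy(2) by blast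
    define z where "z = p @ [ux, uy]"
    have "ux \<noteq> uy" using ux uy disj by blast
    then have z_distinct: "distinct z" using p_distinct ux uy disjoint by (auto simp: z_def)
    have cyc: "cyclic R z"
      using assms(1) p_red hd[OF uy(1)] last[OF ux(1)] red_U[OF ux(1) uy(1)] R_sym
      by (auto simp: z_def cyclic_def successively_append_iff)
    have xz: "x \<in> set z" and yz: "y \<in> set z" using xy ux uy by (auto simp: z_def)
    have no_red: "\<not> R v d" "\<not> R d v" if "v \<in> set p \<union> U" "d \<in> D" for v d
      using that no_exit D_U R_sym by blast+
    have z_sub: "set z \<subseteq> set p \<union> U" using ux uy by (auto simp: z_def)
    \<comment> \<open>The cycle takes one vertex of \<open>U\<close> from each side, which accounts
      for the deficit of one in the frame.\<close>
    interpret blue_frame X Y R B "set z" "U \<inter> X - {ux}" "U \<inter> Y - {uy}" "D \<inter> X" "D \<inter> Y"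
    proof
      show "set z \<union> (U \<inter> X - {ux}) \<union> (U \<inter> Y - {uy}) \<union> D \<inter> X \<union> D \<inter> Y = X \<union> Y"
        using union ux uy by (auto simp: z_def)
      show "set z \<inter> ((U \<inter> X - {ux}) \<union> (U \<inter> Y - {uy}) \<union> D \<inter> X \<union> D \<inter> Y) = {}"
        using ux uy disjoint disj by (auto simp: z_def)
      show "Suc (card (U \<inter> X - {ux})) = card (D \<inter> Y)" "Suc (card (U \<inter> Y - {uy})) = card (D \<inter> X)"
        using ux uy cards finite_DU by (metis card_Suc_Diff1 finite_Int)+
      show "B u v" if "u \<in> U \<inter> X - {ux} \<union> set z \<inter> X" "v \<in> D \<inter> Y" for u v
        using that no_red(1)[of u v] R_or_B[of u v] z_sub by blast
      show "B u v" if "u \<in> U \<inter> Y - {uy} \<union> set z \<inter> Y" "v \<in> D \<inter> X" for u v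
        using that no_red(1)[of u v] R_or_B'[of u v] z_sub by blast
    qed (use disjoint in auto)
    obtain z1 z2 where z: "z = z1 @ x # z2" using xz by (meson split_list)
    have "y \<noteq> x" using xy disj by blast
    then have "y \<in> set (z2 @ z1)" using yz z by auto
    then obtain A C where AC: "z2 @ z1 = A @ y # C" by (meson split_list)
    have "cyclic R (x # A @ y # C)" using cyclic_rotate[of R z1 "x # z2"] cyc z AC by simp
    moreover have "distinct (x # z2 @ z1)" "set (x # z2 @ z1) = set z" using z_distinct z by auto
    ultimately have "two_paths (X \<union> Y) R B"
      using two_paths_by_chord[OF _ _ _ refl \<open>B x y\<close>] AC by metis
    then show ?thesis ..
  qed
qed

lemma two_paths_or_split_if_oriented:
  assumes "p \<noteq> []" "hd p \<in> X" "last p \<in> Y"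
  shows "two_paths (X \<union> Y) R B \<or> (\<exists>S. split_by X Y R S)"
proof -
  have hd_split: "p = [hd p] @ tl p" and last_split: "p = butlast p @ [last p]" using assms(1) by auto
  \<comment> \<open>A blue edge from \<open>hd p\<close> to each of \<open>U \<inter> Y\<close> and
    \<open>D \<inter> Y\<close> makes this single vertex a link between the blue bicliques.\<close>
  have hd: "two_paths (X \<union> Y) R B"
    if "u \<in> U \<inter> Y" "\<not> R (hd p) u" "d \<in> D \<inter> Y" "\<not> R (hd p) d" for u d
  proof (rule two_paths_by_joining[where m = "[hd p]", OF _ _ _ disjI1[OF hd_split]])
    show "successively B (u # [hd p] @ [d])"
      using that assms(2) R_or_B[of "hd p"] B_sym by auto
  qed (use that in auto)
  have last: "two_paths (X \<union> Y) R B"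
    if "u \<in> U \<inter> X" "\<not> R (last p) u" "d \<in> D \<inter> X" "\<not> R (last p) d" for u d
  proof (rule two_paths_by_joining[where m = "[last p]", OF _ _ _ disjI2[OF last_split]])
    show "successively B (d # [last p] @ [u])"
      using that assms(3) R_or_B'[of "last p"] B_sym by auto
  qed (use that in auto)
  interpret du: red_dfs_state X Y R B p U D by (rule swap_D_U)
  \<comment> \<open>Otherwise each end of \<open>p\<close> is red to all opposite vertices of
    \<open>U\<close> or of \<open>D\<close>. The same choice at both ends closes \<open>p\<close> to
    a cycle, different choices make it a bridge.\<close>
  consider "\<forall>u\<in>U \<inter> Y. R (hd p) u" "\<forall>u\<in>U \<inter> X. R (last p) u"
    | "\<forall>d\<in>D \<inter> Y. R (hd p) d" "\<forall>d\<in>D \<inter> X. R (last p) d"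
    | "\<forall>u\<in>U \<inter> Y. R (hd p) u" "\<forall>d\<in>D \<inter> X. R (last p) d"
    | "\<forall>d\<in>D \<inter> Y. R (hd p) d" "\<forall>u\<in>U \<inter> X. R (last p) u"
    | "two_paths (X \<union> Y) R B"
    using hd last by blast
  then show ?thesis
  proof cases
    case 1
    then show ?thesis using two_paths_or_split_if_cycle assms by blast
  next
    case 2
    then show ?thesis using du.two_paths_or_split_if_cycle assms by blast
  next
    case 3
    then show ?thesis using two_paths_by_bridge assms(1) nonempty nonempty_U by blast
  next
    case 4
    then show ?thesis using du.two_paths_by_bridge assms(1) nonempty nonempty_U by blast
  qed simp
qed

lemma two_paths_or_split: "two_paths (X \<union> Y) R B \<or> (\<exists>S. split_by X Y R S)"
proof (cases "p = []")
  case True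
  \<comment> \<open>With \<open>p\<close> empty the two red bicliques cover everything.\<close>
  then show ?thesis using split_by_D red_U by auto
next
  case False
  interpret r: red_dfs_state X Y R B "rev p" D U by (rule rev_p)
  show ?thesis using p_ends[OF False] two_paths_or_split_if_oriented r.two_paths_or_split_if_oriented False
    by (auto simp: hd_rev last_rev)
qed

end

section \<open>Two paths or a split colouring\<close>

context bicoloured
begin

theorem two_paths_or_split: "two_paths (X \<union> Y) R B \<or> (\<exists>S. split_by X Y R S)"
proof -
  obtain p D U where st: "distinct p" "successively R p" "set p \<union> D \<union> U = X \<union> Y" "set p \<inter> D = {}"
     "set p \<inter> U = {}" "D \<inter> U = {}" "card U = card D" "\<forall>d\<in>D. \<forall>u\<in>U. \<not> R d u"
    using finite_path_dfs[of "X \<union> Y" R] fin R_sym by blast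
  have finDU: "finite D" "finite U" using st(3) fin by (metis finite_Un)+
  have side: "card W = card (W \<inter> X) + card (W \<inter> Y)" if "W \<subseteq> X \<union> Y" for W
    using card_Int_parts[of W X Y "{}"] that fin disj by (simp add: Int_commute)
  have p_balance: "card (set p \<inter> X) \<le> Suc (card (set p \<inter> Y))" "card (set p \<inter> Y) \<le> Suc (card (set p \<inter> X))"
  proof -
    have "p = [] \<or> card (set p \<inter> X) + of_bool (last p \<in> Y) = card (set p \<inter> Y) + of_bool (hd p \<in> X)"
      using path_balance[OF st(2) _ st(1)] st(3) by blast
    then show "card (set p \<inter> X) \<le> Suc (card (set p \<inter> Y))" "card (set p \<inter> Y) \<le> Suc (card (set p \<inter> X))"
      by (auto simp: of_bool_def split: if_splits)
  qed
  have cards: "card (U \<inter> X) = card (D \<inter> Y)" "card (U \<inter> Y) = card (D \<inter> X)"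
  proof -
    \<comment> \<open>The equations give \<open>px - py = 2 * (dy - ux)\<close> over the integers;
      an even number of absolute value at most one is zero.\<close>
    have parity: "ux = dy \<and> uy = dx"
      if "px + dx + ux = py + dy + uy" "ux + uy = dx + dy" "px \<le> Suc py" "py \<le> Suc px"
      for ux uy dx dy px py :: nat
      using that by presburger
    have "card (set p \<inter> X) + card (D \<inter> X) + card (U \<inter> X) = card (set p \<inter> Y) + card (D \<inter> Y) + card (U \<inter> Y)"
      using card_Int_parts[of X "set p" D U] card_Int_parts[of Y "set p" D U] st finDU card_eq by simp
    moreover have "card (U \<inter> X) + card (U \<inter> Y) = card (D \<inter> X) + card (D \<inter> Y)"
    proof -
      have "D \<subseteq> X \<union> Y" "U \<subseteq> X \<union> Y" using st(3) by blast+
      then show ?thesis using side[of D] side[of U] st(7) by simp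
    qed
    ultimately show "card (U \<inter> X) = card (D \<inter> Y)" "card (U \<inter> Y) = card (D \<inter> X)"
      using parity p_balance by blast+
  qed
  interpret dfs_state X Y R B p D U
  proof
    show "\<not> R d u" if "d \<in> D" "u \<in> U" for d u using that st(8) by blast
  qed (fact st(1-6) cards)+
  \<comment> \<open>An empty side of \<open>D\<close> leaves a single blue biclique; a blue edge
    inside \<open>D\<close> or inside \<open>U\<close> joins the two directly, with no vertex of
    \<open>p\<close> between them.\<close>
  consider "D \<inter> X = {}" | "D \<inter> Y = {}" | "\<exists>x\<in>D \<inter> X. \<exists>y\<in>D \<inter> Y. \<not> R x y" | "\<exists>x\<in>U \<inter> X. \<exists>y\<in>U \<inter> Y. \<not> R x y"
    | "red_dfs_state X Y R B p D U"
    using red_dfs_state.intro[OF dfs_state_axioms red_dfs_state_axioms.intro] by blast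
  then show ?thesis
  proof cases
    case 1
    then have "U \<inter> Y = {}" using cards(2) finDU(2) by (metis card_0_eq card.empty finite_Int)
    then have DU: "D \<union> U = (D \<inter> Y) \<union> (U \<inter> X)" using 1 st(3) by blast
    have "\<exists>s. distinct s \<and> set s = (D \<inter> Y) \<union> (U \<inter> X) \<and> successively B s"
    proof (rule biclique_path_balanced)
      show "B x y \<and> B y x" if "x \<in> D \<inter> Y" "y \<in> U \<inter> X" for x y
        using that blue_D_U B_sym by blast
    qed (use finDU cards st(6) in auto)
    then obtain s where "distinct s" "set s = D \<union> U" "successively B s" unfolding DU by blast
    moreover have "set p \<inter> (D \<union> U) = {}" using st(4,5) by blast
    ultimately show ?thesis using two_pathsI[of p s] st(1,2,3) by (simp add: Un_assoc)
  next
    case 2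
    then have "U \<inter> X = {}" using cards(1) finDU(2) by (metis card_0_eq card.empty finite_Int)
    then have DU: "D \<union> U = (D \<inter> X) \<union> (U \<inter> Y)" using 2 st(3) by blast
    have "\<exists>s. distinct s \<and> set s = (D \<inter> X) \<union> (U \<inter> Y) \<and> successively B s"
    proof (rule biclique_path_balanced)
      show "B x y \<and> B y x" if "x \<in> D \<inter> X" "y \<in> U \<inter> Y" for x y
        using that blue_D_U B_sym by blast
    qed (use finDU cards st(6) in auto)
    then obtain s where "distinct s" "set s = D \<union> U" "successively B s" unfolding DU by blast
    moreover have "set p \<inter> (D \<union> U) = {}" using st(4,5) by blast
    ultimately show ?thesis using two_pathsI[of p s] st(1,2,3) by (simp add: Un_assoc)
  next
    case 3
    then obtain x y where "x \<in> D \<inter> X" "y \<in> D \<inter> Y" "B x y" using R_or_B by blast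
    then show ?thesis using two_paths_by_joining[of x y "[]" p] by auto
  next
    case 4
    then obtain x y where "x \<in> U \<inter> X" "y \<in> U \<inter> Y" "B y x" using R_or_B B_sym by blast
    then show ?thesis using two_paths_by_joining[of y x "[]" p] by auto
  next
    case 5
    then show ?thesis by (rule red_dfs_state.two_paths_or_split)
  qed
qed

end

section \<open>Translation to edge sets\<close>

theorem theorem4:
  fixes n :: nat and V1 V2 :: "'a set" and c :: "'a set \<Rightarrow> colour"
  assumes "is_Knn n V1 V2"
    and "\<not> split_colouring V1 V2 c"
  shows "\<exists>p q r s.
           is_path (V1 \<union> V2) (bip_edges V1 V2) p \<and>
           is_cycle (V1 \<union> V2) (bip_edges V1 V2) q \<and>
           set p \<union> set q = V1 \<union> V2 \<and> set p \<inter> set q = {} \<and>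
           monochromatic c r (path_edges p) \<and>
           monochromatic c s (cycle_edges q) \<and>
           r \<noteq> s"
proof -
  define R where "R u v \<longleftrightarrow> (u \<in> V1 \<and> v \<in> V2 \<or> u \<in> V2 \<and> v \<in> V1) \<and> c {u, v} = Red" for u v
  define B where "B u v \<longleftrightarrow> (u \<in> V1 \<and> v \<in> V2 \<or> u \<in> V2 \<and> v \<in> V1) \<and> c {u, v} = Blue" for u v
  have knn: "finite V1" "finite V2" "card V1 = card V2" "V1 \<inter> V2 = {}"
    using assms(1) by (auto simp: is_Knn_def)
  interpret bicoloured V1 V2 R B
  proof
    show "R u v \<or> B u v" if "u \<in> V1" "v \<in> V2" for u v
      using that by (cases "c {u, v}") (auto simp: R_def B_def)
  qed (use knn in \<open>auto simp: R_def B_def insert_commute\<close>)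
  have "\<not> split_by V1 V2 R S" for S
  proof
    assume S: "split_by V1 V2 R S"
    \<comment> \<open>The classes are \<open>S \<inter> V1\<close>, \<open>V1 - S\<close> and
      \<open>S \<inter> V2\<close>, \<open>V2 - S\<close>; unification reads them off the
      \<open>show\<close> statements.\<close>
    have "split_colouring V1 V2 c" unfolding split_colouring_def
    proof (intro exI conjI ballI)
      show "S \<inter> V1 \<noteq> {}" "V1 - S \<noteq> {}" "S \<inter> V2 \<noteq> {}" "V2 - S \<noteq> {}" using S by (auto simp: split_by_def)
      show "Red \<noteq> Blue" by simp
      show "c {u, v} = (if u \<in> S \<inter> V1 \<and> v \<in> S \<inter> V2 \<or> u \<in> V1 - S \<and> v \<in> V2 - S then Red else Blue)"
        if "u \<in> V1" "v \<in> V2" for u v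
      proof -
        have "c {u, v} = Red \<longleftrightarrow> (u \<in> S \<longleftrightarrow> v \<in> S)" using S that by (auto simp: split_by_def R_def)
        then show ?thesis using that by (cases "c {u, v}") auto
      qed
    qed auto
    then show False using assms(2) by simp
  qed
  then have "path_and_cycle (V1 \<union> V2) R B"
    using two_paths_or_split path_and_cycle_if_two_paths by blast
  then obtain p q where pq: "distinct (p @ q)" "set (p @ q) = V1 \<union> V2"
    "successively R p \<and> cyclic B q \<or> successively B p \<and> cyclic R q"
    unfolding path_and_cycle_def by blast
  have edge: "{u, v} \<in> bip_edges V1 V2" if "R u v \<or> B u v" for u v
    using that by (auto simp: R_def B_def bip_edges_def insert_commute)
  \<comment> \<open>Tying \<open>E\<close> to \<open>k\<close> treats both colours at once.\<close>
  have path: "path_edges l \<subseteq> bip_edges V1 V2 \<and> monochromatic c k (path_edges l)"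
    if "successively E l" "E = R \<and> k = Red \<or> E = B \<and> k = Blue" for l E k
    using that successively_nth[OF that(1)] edge
    by (fastforce simp: path_edges_def monochromatic_def R_def B_def)
  have cycle: "cycle_edges l \<subseteq> bip_edges V1 V2 \<and> monochromatic c k (cycle_edges l)"
    if "cyclic E l" "E = R \<and> k = Red \<or> E = B \<and> k = Blue" for l E k
    using that path[of E l k] edge[of "last l" "hd l"]
    by (auto simp: cyclic_def cycle_edges_def monochromatic_def R_def B_def)
  show ?thesis using pq(3)
  proof
    assume "successively R p \<and> cyclic B q"
    then show ?thesis using pq(1,2) path[of R p Red] cycle[of B q Blue]
      by (intro exI[of _ p] exI[of _ q] exI[of _ Red] exI[of _ Blue]) (auto simp: is_path_def is_cycle_def)
  next
    assume "successively B p \<and> cyclic R q"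
    then show ?thesis using pq(1,2) path[of B p Blue] cycle[of R q Red]
      by (intro exI[of _ p] exI[of _ q] exI[of _ Blue] exI[of _ Red]) (auto simp: is_path_def is_cycle_def)
  qed
qed

end
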